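(* Let $G$ be a semisimple Lie group, $\Gamma$ a lattice in $G$, $X=\Gamma\backslash G$, and $H$ a subgroup of $G$ acting ergodically on $X$. (1) Assume $\Gamma\backslash G$ is non-compact. For $x\in X$ let $\alpha(x)$ denote the critical exponent corresponding to the shrinking family $A_t=B_{\log t}(\infty)$. Then, for every $x\in X$ such that $\alpha(x)$ is defined, $$\limsup_{t\to\infty}\frac{\beta_t(x)}{\log t}=\alpha(x).$$ (2) Let $y\in X$ (with no assumption on cocompactness of $\Gamma$), and assume that the thickened balls satisfy $\mu(B_s(y)H_1)\asymp s^{d_0}$ (as $s\to 0$) for some exponent $d_0$. Let $\alpha(x,y)$ be the critical exponent corresponding to the shrinking family $A_t=B_{t^{-1/d_0}}(y)H_1$. Then for every $x\in X$ for which $\alpha(x,y)$ is defined, either $y\in xH$ or $$\limsup_{t\to\infty}\frac{-\log\beta_t(x,y)}{\log t}=\frac{\alpha(x,y)}{d_0}.$$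
   Context: Notation: $F\ll G$ means $F\le cG$ for some constant $c>0$ (subscripts indicate what $c$ depends on), and $F\asymp G$ means $c^{-1}F\le G\le cF$ for some constant $c>1$. $\mu$ is the $G$-invariant probability measure on $X=\Gamma\backslash G$, and $H$ acts on $X$ on the right, $x\mapsto xh$. A norm $\|\cdot\|$ on $H$ is fixed, $H_t=\{h\in H:\|h\|\le t\}$, and it is assumed that there are exponents $d_H^-\le d_H^+$ such that for any $\epsilon>0$, $t^{d_H^--\epsilon}\ll_\epsilon m(H_t)\ll_\epsilon t^{d_H^++\epsilon}$, where $m$ is Haar measure on $H$. Bounded subsets of $H$ are bounded with respect to the norm. For $B\subseteq X$, $BH_1=\{xh:x\in B,\ h\in H_1\}$. $\mathrm{dist}$ is any natural distance function on $X$ and $o\in X$ is any fixed base point. Set $B_s(\infty)=\{x\in X:\mathrm{dist}(x,o)>s\}$ and $B_s(y)=\{x\in X:\mathrm{dist}(x,y)<s\}$. The distance function is appropriately normalized so that $\mu(B_s(\infty))\asymp e^{-s}$ as $s\to\infty$ (in the non-compact case). Further, $$\beta_t(x)=\sup_{h\in H_t}\mathrm{dist}(xh,o),\qquad \beta_t(x,y)=\inf_{h\in H_t}\mathrm{dist}(xh,y).$$ For a decreasing family $\{A_t\}_{t\ge1}$ of measurable subsets of $X$ (with $\mu(A_t)\asymp 1/t$), the critical exponent at $x$ is the infimum over all $\eta\ge0$ such that $\{h\in H:xh\in A_{\|h\|^\eta}\}$ is bounded; it is defined if such an exponent exists. *)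

theory Defs
  imports
    "HOL-Algebra.Solvable_Groups"
    "HOL-Library.Landau_Symbols"
    "HOL-Probability.Probability"
begin

section \<open>Semisimple Lie groups\<close>

definition topological_group :: "('g, 'b) monoid_scheme \<Rightarrow> 'g topology \<Rightarrow> bool" where
  "topological_group G T \<longleftrightarrow>
     group G \<and> topspace T = carrier G \<and>
     continuous_map (prod_topology T T) T (\<lambda>(a, b). a \<otimes>\<^bsub>G\<^esub> b) \<and>
     continuous_map T T (\<lambda>a. inv\<^bsub>G\<^esub> a)"

text \<open>The following is only meant for open sets \<open>S\<close>, where it is the usual notion of being
  \<open>k\<close> times continuously differentiable.\<close>

primrec Ck_on :: "nat \<Rightarrow> ('a::euclidean_space \<Rightarrow> 'b::euclidean_space) \<Rightarrow> 'a set \<Rightarrow> bool" where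
  "Ck_on 0 f S \<longleftrightarrow> continuous_on S f"
| "Ck_on (Suc k) f S \<longleftrightarrow>
     (\<forall>x\<in>S. f differentiable (at x)) \<and> (\<forall>v. Ck_on k (\<lambda>x. frechet_derivative f (at x) v) S)"

definition smooth_on :: "('a::euclidean_space \<Rightarrow> 'b::euclidean_space) \<Rightarrow> 'a set \<Rightarrow> bool" where
  "smooth_on f S \<longleftrightarrow> (\<forall>k. Ck_on k f S)"

text \<open>A chart is a pair \<open>(U, \<phi>)\<close> of an open set and a homeomorphism from \<open>U\<close> onto an open subset
  of the Euclidean space \<open>'e\<close>.\<close>

definition smooth_atlas :: "'g topology \<Rightarrow> ('g set \<times> ('g \<Rightarrow> 'e::euclidean_space)) set \<Rightarrow> bool" where
  "smooth_atlas T \<A> \<longleftrightarrow>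
     (\<forall>(U, \<phi>)\<in>\<A>. openin T U \<and> open (\<phi> ` U) \<and>
        homeomorphic_map (subtopology T U) (top_of_set (\<phi> ` U)) \<phi>) \<and>
     (\<Union>(U, \<phi>)\<in>\<A>. U) = topspace T \<and>
     (\<forall>(U, \<phi>)\<in>\<A>. \<forall>(V, \<psi>)\<in>\<A>. smooth_on (\<psi> \<circ> inv_into U \<phi>) (\<phi> ` (U \<inter> V)))"

definition smooth_operations ::
  "('g, 'b) monoid_scheme \<Rightarrow> ('g set \<times> ('g \<Rightarrow> 'e::euclidean_space)) set \<Rightarrow> bool" where
  "smooth_operations G \<A> \<longleftrightarrow>
     (\<forall>(U, \<phi>)\<in>\<A>. \<forall>(V, \<psi>)\<in>\<A>. \<forall>(W, \<theta>)\<in>\<A>.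
        smooth_on (\<lambda>(a, b). \<theta> (inv_into U \<phi> a \<otimes>\<^bsub>G\<^esub> inv_into V \<psi> b))
          {(\<phi> g, \<psi> h) | g h. g \<in> U \<and> h \<in> V \<and> g \<otimes>\<^bsub>G\<^esub> h \<in> W}) \<and>
     (\<forall>(U, \<phi>)\<in>\<A>. \<forall>(V, \<psi>)\<in>\<A>.
        smooth_on (\<lambda>a. \<psi> (inv\<^bsub>G\<^esub> (inv_into U \<phi> a))) {\<phi> g | g. g \<in> U \<and> inv\<^bsub>G\<^esub> g \<in> V})"

text \<open>Types of class \<^class>\<open>euclidean_space\<close> have positive dimension, so the zero-dimensional
  Lie groups, i.e. the countable discrete ones, need a separate disjunct.\<close>

definition lie_group ::
  "('g, 'b) monoid_scheme \<Rightarrow> 'g topology \<Rightarrow> ('g set \<times> ('g \<Rightarrow> 'e::euclidean_space)) set \<Rightarrow> bool" where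
  "lie_group G T \<A> \<longleftrightarrow>
     topological_group G T \<and> Hausdorff_space T \<and> second_countable T \<and>
     (T = discrete_topology (carrier G) \<or> smooth_atlas T \<A> \<and> smooth_operations G \<A>)"

text \<open>Semisimple means that the radical (the largest connected solvable normal subgroup) is
  trivial. \<open>G\<close> itself need not be connected.\<close>

definition semisimple_lie_group ::
  "('g, 'b) monoid_scheme \<Rightarrow> 'g topology \<Rightarrow> ('g set \<times> ('g \<Rightarrow> 'e::euclidean_space)) set \<Rightarrow> bool" where
  "semisimple_lie_group G T \<A> \<longleftrightarrow>
     lie_group G T \<A> \<and>
     (\<forall>N. N \<lhd> G \<and> connectedin T N \<and> solvable (G\<lparr>carrier := N\<rparr>) \<longrightarrow> N = {\<one>\<^bsub>G\<^esub>})"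


section \<open>The homogeneous space\<close>

text \<open>The space \<open>X = \<Gamma>\<setminus>G\<close> is \<open>rcosets\<^bsub>G\<^esub> \<Gamma>\<close>, the set of all \<open>\<Gamma>g\<close>, and the right action of \<open>G\<close>
  on it is \<open>x #>\<^bsub>G\<^esub> g\<close>.\<close>

definition quotient_topology :: "('g, 'b) monoid_scheme \<Rightarrow> 'g topology \<Rightarrow> 'g set \<Rightarrow> 'g set topology" where
  "quotient_topology G T \<Gamma> =
     topology (\<lambda>U. U \<subseteq> rcosets\<^bsub>G\<^esub> \<Gamma> \<and> openin T {g \<in> carrier G. \<Gamma> #>\<^bsub>G\<^esub> g \<in> U})"

lemma openin_quotient_topology:
  assumes "topspace T = carrier G"
  shows "openin (quotient_topology G T \<Gamma>) U \<longleftrightarrow>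
           U \<subseteq> rcosets\<^bsub>G\<^esub> \<Gamma> \<and> openin T {g \<in> carrier G. \<Gamma> #>\<^bsub>G\<^esub> g \<in> U}"
proof -
  define P where
    "P U \<longleftrightarrow> U \<subseteq> rcosets\<^bsub>G\<^esub> \<Gamma> \<and> openin T {g \<in> carrier G. \<Gamma> #>\<^bsub>G\<^esub> g \<in> U}" for U
  have "istopology P"
    unfolding istopology_def
  proof (intro conjI allI impI)
    fix S U assume "P S" "P U"
    moreover have "{g \<in> carrier G. \<Gamma> #>\<^bsub>G\<^esub> g \<in> S \<inter> U} =
        {g \<in> carrier G. \<Gamma> #>\<^bsub>G\<^esub> g \<in> S} \<inter> {g \<in> carrier G. \<Gamma> #>\<^bsub>G\<^esub> g \<in> U}"
      by auto
    ultimately show "P (S \<inter> U)"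
      unfolding P_def by auto
  next
    fix \<K> assume "\<forall>K\<in>\<K>. P K"
    moreover have "{g \<in> carrier G. \<Gamma> #>\<^bsub>G\<^esub> g \<in> \<Union>\<K>} =
        (\<Union>K\<in>\<K>. {g \<in> carrier G. \<Gamma> #>\<^bsub>G\<^esub> g \<in> K})"
      by auto
    ultimately show "P (\<Union>\<K>)"
      unfolding P_def by auto
  qed
  then show ?thesis
    unfolding quotient_topology_def P_def by (simp add: topology_inverse')
qed

definition borel_measure_on :: "'a topology \<Rightarrow> 'a measure \<Rightarrow> bool" where
  "borel_measure_on T M \<longleftrightarrow>
     space M = topspace T \<and> sets M = sigma_sets (topspace T) {U. openin T U}"

definition invariant_probability ::
  "('g, 'b) monoid_scheme \<Rightarrow> 'g topology \<Rightarrow> 'g set \<Rightarrow> 'g set measure \<Rightarrow> bool" where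
  "invariant_probability G T \<Gamma> \<mu> \<longleftrightarrow>
     borel_measure_on (quotient_topology G T \<Gamma>) \<mu> \<and> prob_space \<mu> \<and>
     (\<forall>g\<in>carrier G. \<forall>A\<in>sets \<mu>. emeasure \<mu> ((\<lambda>x. x #>\<^bsub>G\<^esub> g) ` A) = emeasure \<mu> A)"

definition lattice_subgroup :: "('g, 'b) monoid_scheme \<Rightarrow> 'g topology \<Rightarrow> 'g set \<Rightarrow> bool" where
  "lattice_subgroup G T \<Gamma> \<longleftrightarrow>
     subgroup \<Gamma> G \<and> subtopology T \<Gamma> = discrete_topology \<Gamma> \<and>
     (\<exists>\<mu>. invariant_probability G T \<Gamma> \<mu>)"

definition ergodic_action ::
  "('g, 'b) monoid_scheme \<Rightarrow> 'g set \<Rightarrow> 'g set measure \<Rightarrow> bool" where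
  "ergodic_action G H \<mu> \<longleftrightarrow>
     (\<forall>A\<in>sets \<mu>. (\<forall>h\<in>H. (\<lambda>x. x #>\<^bsub>G\<^esub> h) ` A = A) \<longrightarrow> measure \<mu> A = 0 \<or> measure \<mu> A = 1)"


section \<open>The acting group: topology, Haar measure and norm\<close>

text \<open>\<open>H\<close> carries a locally compact group topology for which the inclusion into \<open>G\<close> is continuous.
  For a closed subgroup this can be the induced topology; immersed Lie subgroups are covered too.\<close>

definition locally_compact_subgroup ::
  "('g, 'b) monoid_scheme \<Rightarrow> 'g topology \<Rightarrow> 'g set \<Rightarrow> 'g topology \<Rightarrow> bool" where
  "locally_compact_subgroup G T H T\<^sub>H \<longleftrightarrow>
     subgroup H G \<and> topological_group (G\<lparr>carrier := H\<rparr>) T\<^sub>H \<and>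
     Hausdorff_space T\<^sub>H \<and> locally_compact_space T\<^sub>H \<and> continuous_map T\<^sub>H T (\<lambda>h. h)"

definition radon_measure :: "'a topology \<Rightarrow> 'a measure \<Rightarrow> bool" where
  "radon_measure T M \<longleftrightarrow>
     borel_measure_on T M \<and>
     (\<forall>K. compactin T K \<longrightarrow> emeasure M K < \<infinity>) \<and>
     (\<forall>A\<in>sets M. emeasure M A = (INF U\<in>{U. openin T U \<and> A \<subseteq> U}. emeasure M U)) \<and>
     (\<forall>U. openin T U \<longrightarrow> emeasure M U = (SUP K\<in>{K. compactin T K \<and> K \<subseteq> U}. emeasure M K))"

text \<open>\<open>H\<close> need not be unimodular, and either a left or a right Haar measure is allowed.\<close>

definition haar_measure :: "('g, 'b) monoid_scheme \<Rightarrow> 'g topology \<Rightarrow> 'g measure \<Rightarrow> bool" where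
  "haar_measure H T\<^sub>H m \<longleftrightarrow>
     radon_measure T\<^sub>H m \<and> emeasure m (space m) \<noteq> 0 \<and>
     ((\<forall>h\<in>carrier H. \<forall>A\<in>sets m. emeasure m (h <#\<^bsub>H\<^esub> A) = emeasure m A) \<or>
      (\<forall>h\<in>carrier H. \<forall>A\<in>sets m. emeasure m (A #>\<^bsub>H\<^esub> h) = emeasure m A))"

text \<open>The properties of the restriction to \<open>H\<close> of a vector space norm on matrices: such a norm is
  submultiplicative only up to a constant.\<close>

definition group_norm :: "('g, 'b) monoid_scheme \<Rightarrow> 'g topology \<Rightarrow> ('g \<Rightarrow> real) \<Rightarrow> bool" where
  "group_norm H T\<^sub>H N \<longleftrightarrow>
     continuous_map T\<^sub>H euclideanreal N \<and>
     (\<forall>h\<in>carrier H. 0 < N h) \<and>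
     (\<exists>C. \<forall>g\<in>carrier H. \<forall>h\<in>carrier H. N (g \<otimes>\<^bsub>H\<^esub> h) \<le> C * N g * N h)"

definition norm_ball :: "'g set \<Rightarrow> ('g \<Rightarrow> real) \<Rightarrow> real \<Rightarrow> 'g set" where
  "norm_ball H N t = {h \<in> H. N h \<le> t}"

definition norm_bounded :: "('g \<Rightarrow> real) \<Rightarrow> 'g set \<Rightarrow> bool" where
  "norm_bounded N S \<longleftrightarrow> (\<exists>R. \<forall>h\<in>S. N h \<le> R)"

text \<open>The growth bounds are stated with \<^const>\<open>emeasure\<close>, so that the upper bound entails
  finiteness of the measure of the norm balls.\<close>

definition norm_growth :: "'g measure \<Rightarrow> 'g set \<Rightarrow> ('g \<Rightarrow> real) \<Rightarrow> real \<Rightarrow> real \<Rightarrow> bool" where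
  "norm_growth m H N dlo dhi \<longleftrightarrow>
     (\<forall>\<epsilon>>0. \<exists>c>0. \<forall>\<^sub>F t in at_top.
        ennreal (t powr (dlo - \<epsilon>)) \<le> ennreal c * emeasure m (norm_ball H N t) \<and>
        emeasure m (norm_ball H N t) \<le> ennreal (c * t powr (dhi + \<epsilon>)))"


section \<open>Shrinking targets\<close>

definition ball_at_infinity :: "'x set \<Rightarrow> ('x \<Rightarrow> 'x \<Rightarrow> real) \<Rightarrow> 'x \<Rightarrow> real \<Rightarrow> 'x set" where
  "ball_at_infinity X d p s = {x \<in> X. d x p > s}"

definition thickened_ball ::
  "('g, 'b) monoid_scheme \<Rightarrow> 'g set \<Rightarrow> 'g set \<Rightarrow> ('g \<Rightarrow> real) \<Rightarrow>
   ('g set \<Rightarrow> 'g set \<Rightarrow> real) \<Rightarrow> 'g set \<Rightarrow> real \<Rightarrow> 'g set set" where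
  "thickened_ball G \<Gamma> H N d y s =
     {x #>\<^bsub>G\<^esub> h | x h. x \<in> Metric_space.mball (rcosets\<^bsub>G\<^esub> \<Gamma>) d y s \<and> h \<in> norm_ball H N 1}"

definition critical_set ::
  "('g, 'b) monoid_scheme \<Rightarrow> 'g set \<Rightarrow> ('g \<Rightarrow> real) \<Rightarrow> (real \<Rightarrow> 'g set set) \<Rightarrow> 'g set \<Rightarrow> real set" where
  "critical_set G H N A x =
     {\<eta>. \<eta> \<ge> 0 \<and> norm_bounded N {h \<in> H. x #>\<^bsub>G\<^esub> h \<in> A (N h powr \<eta>)}}"

definition critical_exponent_defined ::
  "('g, 'b) monoid_scheme \<Rightarrow> 'g set \<Rightarrow> ('g \<Rightarrow> real) \<Rightarrow> (real \<Rightarrow> 'g set set) \<Rightarrow> 'g set \<Rightarrow> bool" where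
  "critical_exponent_defined G H N A x \<longleftrightarrow> critical_set G H N A x \<noteq> {}"

definition critical_exponent ::
  "('g, 'b) monoid_scheme \<Rightarrow> 'g set \<Rightarrow> ('g \<Rightarrow> real) \<Rightarrow> (real \<Rightarrow> 'g set set) \<Rightarrow> 'g set \<Rightarrow> real" where
  "critical_exponent G H N A x = Inf (critical_set G H N A x)"

text \<open>\<open>beta_sup\<close> takes values in \<^typ>\<open>ereal\<close> because a real-valued supremum of an unbounded set is
  meaningless. The infimum in \<open>beta_inf\<close> is over a set bounded below by 0, nonempty for large \<open>t\<close>.\<close>

definition beta_sup ::
  "('g, 'b) monoid_scheme \<Rightarrow> 'g set \<Rightarrow> ('g \<Rightarrow> real) \<Rightarrow> ('g set \<Rightarrow> 'g set \<Rightarrow> real) \<Rightarrow>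
   'g set \<Rightarrow> real \<Rightarrow> 'g set \<Rightarrow> ereal" where
  "beta_sup G H N d p t x = (SUP h\<in>norm_ball H N t. ereal (d (x #>\<^bsub>G\<^esub> h) p))"

definition beta_inf ::
  "('g, 'b) monoid_scheme \<Rightarrow> 'g set \<Rightarrow> ('g \<Rightarrow> real) \<Rightarrow> ('g set \<Rightarrow> 'g set \<Rightarrow> real) \<Rightarrow>
   real \<Rightarrow> 'g set \<Rightarrow> 'g set \<Rightarrow> real" where
  "beta_inf G H N d t x y = (INF h\<in>norm_ball H N t. d (x #>\<^bsub>G\<^esub> h) y)"

end

theory Submission
  imports Defs
begin

text \<open>Finiteness of the Haar measure of all large norm balls forces the norm balls of \<open>H\<close> to be
  compact, so that on each of them \<open>h \<mapsto> dist(xh, z)\<close> is bounded, and bounded away from 0 if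
  \<open>z \<notin> xH\<close>. Hence only elements of large norm matter. If \<open>\<eta>\<close> belongs to the critical set, then
  \<open>dist(xh, o) \<le> \<eta> log \<parallel>h\<parallel>\<close> for all such \<open>h\<close>; if it does not, the reverse inequality holds along a
  sequence with \<open>\<parallel>h\<parallel> \<rightarrow> \<infinity>\<close>. The second part is the same for \<open>- log dist(xh, y)\<close>, where thickening
  by \<open>H\<^sub>1\<close> replaces \<open>h\<close> by some \<open>h'\<close> whose norm is comparable to \<open>\<parallel>h\<parallel>\<close>, which does not change
  the logarithmic rate.\<close>

section \<open>Limsup formulas for abstract orbit functions\<close>

text \<open>Elements of \<open>S\<close> close to \<open>Inf S\<close> bound the limsup from above,
  and points just below \<open>Inf S\<close>, which lie outside \<open>S\<close>, bound it from
  below, each up to an arbitrary error. The factor \<open>c\<close> is 1 for excursions to infinity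
  and \<open>1 / d\<close> for approach to a point.\<close>

lemma Limsup_at_top_eq_Inf:
  fixes f :: "real \<Rightarrow> ereal" and S :: "real set"
  assumes S: "S \<noteq> {}" "S \<subseteq> {0..}" and c: "0 < c"
    and upper: "\<And>\<eta> e. \<eta> \<in> S \<Longrightarrow> 0 < e \<Longrightarrow> \<forall>\<^sub>F t in at_top. f t \<le> ereal (c * \<eta> + e)"
    and lower: "\<And>\<eta> e. 0 \<le> \<eta> \<Longrightarrow> \<eta> \<notin> S \<Longrightarrow> 0 < e \<Longrightarrow> \<exists>\<^sub>F t in at_top. ereal (c * \<eta> - e) \<le> f t"
    and nonneg: "\<And>e. 0 < e \<Longrightarrow> \<forall>\<^sub>F t in at_top. ereal (- e) \<le> f t"
  shows "Limsup at_top f = ereal (c * Inf S)"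
proof (rule antisym)
  have bdd: "bdd_below S" using S(2) by (meson bdd_below_Ici bdd_below_mono)
  show "Limsup at_top f \<le> ereal (c * Inf S)"
  proof (rule ereal_le_epsilon2)
    fix e :: real assume e: "0 < e"
    \<comment> \<open>The gap \<open>e / (2 * c)\<close> becomes \<open>e / 2\<close> after scaling
      by \<open>c\<close>; the other half of \<open>e\<close> is the error allowed in
      \<open>upper\<close>.\<close>
    obtain \<eta> where \<eta>: "\<eta> \<in> S" "\<eta> < Inf S + e / (2 * c)"
      using cInf_lessD[OF S(1), of "Inf S + e / (2 * c)"] e c by auto
    have "Limsup at_top f \<le> ereal (c * \<eta> + e / 2)"
      using upper[OF \<eta>(1), of "e / 2"] e by (intro Limsup_bounded) auto
    also have "c * \<eta> + e / 2 \<le> c * Inf S + e"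
      using mult_strict_left_mono[OF \<eta>(2) c] c by (simp add: distrib_left)
    finally show "Limsup at_top f \<le> ereal (c * Inf S) + ereal e" by simp
  qed
  have frequent: "C \<le> Limsup at_top f" if "\<exists>\<^sub>F t in at_top. C \<le> f t" for C
  proof (rule ccontr)
    assume "\<not> C \<le> Limsup at_top f"
    then have "\<forall>\<^sub>F t in at_top. f t < C"
      using Limsup_le_iff[of at_top f "Limsup at_top f"] by auto
    with that show False by (simp add: frequently_def not_le)
  qed
  show "ereal (c * Inf S) \<le> Limsup at_top f"
  proof (rule ereal_le_epsilon2)
    fix e :: real assume e: "0 < e"
    \<comment> \<open>The point \<open>Inf S - e / (2 * c)\<close> is outside \<open>S\<close>, but
      \<open>lower\<close> accepts it only if it is nonnegative; otherwise the wanted bound is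
      negative and \<open>nonneg\<close> gives it.\<close>
    have "\<exists>\<^sub>F t in at_top. ereal (c * Inf S - e) \<le> f t"
    proof (cases "Inf S - e / (2 * c) < 0")
      case True
      then have "c * Inf S - e \<le> - (e / 2)"
        using mult_strict_left_mono[OF True c] c by (simp add: right_diff_distrib)
      then have "\<forall>\<^sub>F t in at_top. ereal (c * Inf S - e) \<le> f t"
        using nonneg[of "e / 2"] e by (auto elim!: eventually_mono intro: order_trans[rotated])
      then show ?thesis by (simp add: eventually_frequently)
    next
      case False
      have "Inf S - e / (2 * c) \<notin> S"
        using cInf_lower[OF _ bdd, of "Inf S - e / (2 * c)"] e c by (auto simp: field_simps)
      from lower[OF _ this, of "e / 2"] show ?thesis
        using False e c by (simp add: right_diff_distrib)
    qed
    from frequent[OF this] show "ereal (c * Inf S) \<le> Limsup at_top f + ereal e"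
      by (cases "Limsup at_top f") auto
  qed
qed

lemma eventually_le_mult_ln:
  fixes B e :: real
  assumes "0 < e"
  shows "\<forall>\<^sub>F t in at_top. B \<le> e * ln t"
proof -
  have "\<forall>\<^sub>F t in at_top. B / e \<le> ln t"
    using ln_at_top by (simp add: filterlim_at_top)
  then show ?thesis
    using assms by (auto elim!: eventually_mono simp: field_simps)
qed

lemma frequently_at_topI:
  fixes P :: "real \<Rightarrow> bool"
  assumes "\<And>R. \<exists>t\<ge>R. P t"
  shows "\<exists>\<^sub>F t in at_top. P t"
  using assms by (auto simp: frequently_def eventually_at_top_linorder)

lemma eventually_norm_ball_nonempty:
  assumes "H \<noteq> {}"
  shows "\<forall>\<^sub>F t in at_top. norm_ball H N t \<noteq> {}"
proof -
  obtain h where "h \<in> H" using assms by blast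
  then show ?thesis
    by (intro eventually_mono[OF eventually_ge_at_top[of "N h"]]) (auto simp: norm_ball_def)
qed

text \<open>Let \<open>D h\<close> be the distance from \<open>xh\<close> to the base point. Then
  \<eta> in \<open>S\<close> means \<open>D h \<le> \<eta> * ln (N h)\<close> outside some norm
  ball, while \<eta> \<ge> 0 outside \<open>S\<close> gives the opposite inequality at elements of
  arbitrarily large norm; the choice \<open>t = N h\<close> at these elements yields the lower
  bound.\<close>

lemma limsup_sup_orbit:
  fixes H :: "'h set" and D N :: "'h \<Rightarrow> real"
  defines "S \<equiv> {\<eta>. 0 \<le> \<eta> \<and> norm_bounded N {h \<in> H. ln (N h powr \<eta>) < D h}}"
  assumes H: "H \<noteq> {}" and S: "S \<noteq> {}"
    and N: "\<And>h. h \<in> H \<Longrightarrow> 0 < N h"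
    and D: "\<And>h. h \<in> H \<Longrightarrow> 0 \<le> D h"
    and bounded: "\<And>R. \<exists>C. \<forall>h\<in>norm_ball H N R. D h \<le> C"
  shows "Limsup at_top (\<lambda>t. (SUP h\<in>norm_ball H N t. ereal (D h)) / ereal (ln t)) = ereal (Inf S)"
proof -
  define f where "f = (\<lambda>t. (SUP h\<in>norm_ball H N t. ereal (D h)) / ereal (ln t))"
  have le_f: "ereal (D h / ln t) \<le> f t" if "h \<in> H" "N h \<le> t" "1 < t" for h t
  proof -
    have "ereal (D h) \<le> (SUP h\<in>norm_ball H N t. ereal (D h))"
      using that by (intro SUP_upper) (auto simp: norm_ball_def)
    then have "ereal (D h) / ereal (ln t) \<le> f t"
      unfolding f_def using that by (intro ereal_divide_right_mono) auto
    then show ?thesis using that by simp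
  qed
  have "Limsup at_top f = ereal (1 * Inf S)"
  proof (rule Limsup_at_top_eq_Inf)
    show "S \<noteq> {}" "S \<subseteq> {0..}" using S by (auto simp: S_def)
  next
    fix \<eta> e :: real assume \<eta>: "\<eta> \<in> S" and e: "0 < e"
    then obtain R where R: "\<And>h. h \<in> H \<Longrightarrow> ln (N h powr \<eta>) < D h \<Longrightarrow> N h \<le> R"
      by (auto simp: S_def norm_bounded_def)
    \<comment> \<open>Elements of norm at most \<open>R\<close> are not controlled by \<eta>; their
      constant bound \<open>C\<close> disappears into \<open>e * ln t\<close> for large
      \<open>t\<close>.\<close>
    obtain C where C: "\<And>h. h \<in> norm_ball H N R \<Longrightarrow> D h \<le> C" using bounded[of R] by blast
    show "\<forall>\<^sub>F t in at_top. f t \<le> ereal (1 * \<eta> + e)"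
      using eventually_gt_at_top[of 1] eventually_le_mult_ln[OF e, of C]
    proof eventually_elim
      case (elim t)
      then have lnt: "0 < ln t" by simp
      have "D h \<le> (\<eta> + e) * ln t" if h: "h \<in> norm_ball H N t" for h
      proof (cases "N h \<le> R")
        case True
        then have "D h \<le> C" using C h by (auto simp: norm_ball_def)
        also have "C \<le> e * ln t" by (rule elim)
        also have "\<dots> \<le> (\<eta> + e) * ln t" using \<eta> lnt by (simp add: S_def)
        finally show ?thesis .
      next
        case False
        then have "D h \<le> ln (N h powr \<eta>)" using R h by (force simp: norm_ball_def)
        also have "\<dots> = \<eta> * ln (N h)" using N h by (simp add: ln_powr norm_ball_def)
        also have "\<dots> \<le> \<eta> * ln t"
          using \<eta> h N[of h] by (intro mult_left_mono) (auto simp: S_def norm_ball_def)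
        also have "\<dots> \<le> (\<eta> + e) * ln t" using e lnt by (simp add: distrib_right)
        finally show ?thesis .
      qed
      then have "(SUP h\<in>norm_ball H N t. ereal (D h)) \<le> ereal ((\<eta> + e) * ln t)"
        by (intro SUP_least) simp
      then have "f t \<le> ereal ((\<eta> + e) * ln t) / ereal (ln t)"
        unfolding f_def using lnt by (intro ereal_divide_right_mono) auto
      then show ?case using lnt by simp
    qed
  next
    fix \<eta> e :: real assume \<eta>: "0 \<le> \<eta>" "\<eta> \<notin> S" and e: "0 < e"
    show "\<exists>\<^sub>F t in at_top. ereal (1 * \<eta> - e) \<le> f t"
    proof (rule frequently_at_topI)
      fix R
      \<comment> \<open>Testing against \<open>max R 1\<close> produces an element whose norm
        exceeds \<open>R\<close> and also has a positive logarithm to divide by.\<close>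
      have "\<not> (\<forall>h\<in>{h \<in> H. ln (N h powr \<eta>) < D h}. N h \<le> max R 1)"
        using \<eta> unfolding S_def norm_bounded_def by blast
      then obtain h where h: "h \<in> H" "ln (N h powr \<eta>) < D h" "max R 1 < N h"
        by (auto simp only: not_le mem_Collect_eq Ball_def not_all not_imp)
      have "(\<eta> - e) * ln (N h) \<le> \<eta> * ln (N h)" using h e by (intro mult_right_mono) auto
      also have "\<dots> \<le> D h" using h by (simp add: ln_powr)
      finally have "\<eta> - e \<le> D h / ln (N h)" using h by (simp add: pos_le_divide_eq)
      then have "ereal (1 * \<eta> - e) \<le> f (N h)"
        using le_f[of h "N h"] h by (auto intro: order_trans[rotated])
      then show "\<exists>t\<ge>R. ereal (1 * \<eta> - e) \<le> f t" using h by (intro exI[of _ "N h"]) auto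
    qed
  next
    \<comment> \<open>The supremum over an empty ball is minus infinity, so the bound starts only
      where the ball contains a point.\<close>
    fix e :: real assume e: "0 < e"
    show "\<forall>\<^sub>F t in at_top. ereal (- e) \<le> f t"
      using eventually_norm_ball_nonempty[OF H, of N] eventually_gt_at_top[of 1]
    proof eventually_elim
      case (elim t)
      then obtain h where h: "h \<in> H" "N h \<le> t" by (auto simp: norm_ball_def)
      have "- e \<le> 0" using e by simp
      also have "0 \<le> D h / ln t" using D h elim by simp
      finally show ?case using le_f[OF h elim(2)] by (auto intro: order_trans[rotated])
    qed
  qed simp
  then show ?thesis by (simp add: f_def)
qed

text \<open>The relation \<open>E h h'\<close> abstracts \<open>h \<in> h' H\<^sub>1\<close>.\<close>

lemma limsup_inf_orbit:
  fixes H :: "'h set" and d :: real and D N :: "'h \<Rightarrow> real" and E :: "'h \<Rightarrow> 'h \<Rightarrow> bool"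
  defines "S \<equiv> {\<eta>. 0 \<le> \<eta> \<and>
    norm_bounded N {h \<in> H. \<exists>h'\<in>H. E h h' \<and> D h' < (N h powr \<eta>) powr (- 1 / d)}}"
  assumes H: "H \<noteq> {}" and S: "S \<noteq> {}" and d: "0 < d" and C: "1 \<le> C"
    and N: "\<And>h. h \<in> H \<Longrightarrow> 0 < N h"
    and E: "\<And>h'. h' \<in> H \<Longrightarrow> \<exists>h\<in>H. E h h'"
      "\<And>h h'. h \<in> H \<Longrightarrow> h' \<in> H \<Longrightarrow> E h h' \<Longrightarrow> N h \<le> C * N h'"
      "\<And>h h'. h \<in> H \<Longrightarrow> h' \<in> H \<Longrightarrow> E h h' \<Longrightarrow> N h' \<le> C * N h"
    and pos: "\<And>R. \<exists>\<delta>>0. \<forall>h\<in>norm_ball H N R. \<delta> \<le> D h"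
  shows "Limsup at_top (\<lambda>t. ereal (- ln (INF h\<in>norm_ball H N t. D h) / ln t)) = ereal (Inf S / d)"
proof -
  define b where "b = (\<lambda>t. INF h\<in>norm_ball H N t. D h)"
  have b_le: "b t \<le> D h" if "h \<in> H" "N h \<le> t" for h t
    unfolding b_def
  proof (rule cINF_lower)
    show "bdd_below (D ` norm_ball H N t)" using pos[of t] by (meson bdd_belowI2)
  qed (use that in \<open>auto simp: norm_ball_def\<close>)
  have b_ge: "r \<le> b t" if "norm_ball H N t \<noteq> {}" "\<And>h. h \<in> norm_ball H N t \<Longrightarrow> r \<le> D h" for r t
    unfolding b_def using that by (rule cINF_greatest)
  \<comment> \<open>The uniform bound from \<open>pos\<close> survives passing to the infimum, so
    that \<open>ln (b t)\<close> is a genuine logarithm.\<close>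
  have b_pos: "0 < b t" if "h \<in> H" "N h \<le> t" for h t
    using pos[of t] b_ge[of t] that by (force simp: norm_ball_def)
  \<comment> \<open>In exponential form the target radius is compared with powers of
    \<open>t\<close> through exponents alone.\<close>
  have powr_eq: "(N h powr \<eta>) powr (- 1 / d) = exp (- (\<eta> / d) * ln (N h))" if "h \<in> H" for h \<eta>
    using N[OF that] by (simp add: powr_powr powr_def)
  have "Limsup at_top (\<lambda>t. ereal (- ln (b t) / ln t)) = ereal (1 / d * Inf S)"
  proof (rule Limsup_at_top_eq_Inf)
    show "S \<noteq> {}" "S \<subseteq> {0..}" "0 < 1 / d" using S d by (auto simp: S_def)
  next
    fix \<eta> e :: real assume \<eta>: "\<eta> \<in> S" and e: "0 < e"
    then have \<eta>0: "0 \<le> \<eta> / d" using d by (simp add: S_def)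
    obtain R where R: "\<And>h h'. h \<in> H \<Longrightarrow> h' \<in> H \<Longrightarrow> E h h' \<Longrightarrow>
        D h' < (N h powr \<eta>) powr (- 1 / d) \<Longrightarrow> N h \<le> R"
      using \<eta> by (auto simp: S_def norm_bounded_def)
    \<comment> \<open>Since \<open>E\<close> distorts norms by at most the factor \<open>C\<close>,
      \<open>N h' > C * R\<close> forces \<open>N h > R\<close> for a partner \<open>h\<close>, and
      \<eta> then controls \<open>D h'\<close>. On the ball of radius \<open>C * R\<close> only the
      uniform bound \<delta> is available.\<close>
    obtain \<delta> where \<delta>: "0 < \<delta>" "\<And>h. h \<in> norm_ball H N (C * R) \<Longrightarrow> \<delta> \<le> D h"
      using pos[of "C * R"] by blast
    show "\<forall>\<^sub>F t in at_top. ereal (- ln (b t) / ln t) \<le> ereal (1 / d * \<eta> + e)"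
      \<comment> \<open>The two allowances within \<open>e * ln t\<close> pay for \<delta> on the
        small ball and for the factor \<open>C\<close> lost in bounding \<open>N h\<close> by
        \<open>C * t\<close>.\<close>
      using eventually_gt_at_top[of 1] eventually_norm_ball_nonempty[OF H, of N]
        eventually_le_mult_ln[OF e, of "- ln \<delta>"] eventually_le_mult_ln[OF e, of "\<eta> / d * ln C"]
    proof eventually_elim
      case (elim t)
      then have lnt: "0 < ln t" by simp
      have "exp (- (\<eta> / d + e) * ln t) \<le> D h'" if h': "h' \<in> norm_ball H N t" for h'
      proof (cases "N h' \<le> C * R")
        case True
        have "0 \<le> \<eta> / d * ln t" using \<eta>0 lnt by (intro mult_nonneg_nonneg) auto
        then have "- (\<eta> / d + e) * ln t \<le> - (e * ln t)" by (simp add: algebra_simps)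
        also have "\<dots> \<le> ln \<delta>" using elim(3) by simp
        finally have "exp (- (\<eta> / d + e) * ln t) \<le> exp (ln \<delta>)" by (simp only: exp_le_cancel_iff)
        also have "\<dots> \<le> D h'" using \<delta> True h' by (simp add: norm_ball_def)
        finally show ?thesis .
      next
        case False
        have "h' \<in> H" using h' by (simp add: norm_ball_def)
        then obtain h where h: "h \<in> H" "E h h'" using E(1) by blast
        have "C * R < C * N h" using False E(3)[OF h(1) \<open>h' \<in> H\<close> h(2)] by simp
        then have "R < N h" using C by simp
        have "N h \<le> C * N h'" by (rule E(2)[OF h(1) \<open>h' \<in> H\<close> h(2)])
        also have "\<dots> \<le> C * t" using h' C by (intro mult_left_mono) (auto simp: norm_ball_def)
        finally have "ln (N h) \<le> ln (C * t)" using N[OF h(1)] by (simp add: ln_mono)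
        also have "\<dots> = ln C + ln t" using C elim by (simp add: ln_mult)
        finally have "\<eta> / d * ln (N h) \<le> \<eta> / d * (ln C + ln t)" using \<eta>0 by (rule mult_left_mono)
        also have "\<dots> \<le> (\<eta> / d + e) * ln t" using elim(4) by (simp add: algebra_simps)
        finally have "exp (- (\<eta> / d + e) * ln t) \<le> exp (- (\<eta> / d) * ln (N h))"
          by (simp only: exp_le_cancel_iff)
        also have "\<dots> \<le> D h'"
          using R[OF h(1) \<open>h' \<in> H\<close> h(2)] \<open>R < N h\<close> powr_eq[OF h(1), of \<eta>] by force
        finally show ?thesis .
      qed
      then have "exp (- (\<eta> / d + e) * ln t) \<le> b t" using elim by (intro b_ge)
      then have "- (\<eta> / d + e) * ln t \<le> ln (b t)"
        by (subst ln_ge_iff) (auto intro: less_le_trans[OF exp_gt_zero])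
      then have "- ln (b t) \<le> (\<eta> / d + e) * ln t" by (simp only: mult_minus_left)
      then have "- ln (b t) / ln t \<le> \<eta> / d + e" using lnt by (simp only: pos_divide_le_eq)
      then show ?case by simp
    qed
  next
    fix \<eta> e :: real assume \<eta>: "0 \<le> \<eta>" "\<eta> \<notin> S" and e: "0 < e"
    obtain T where T: "\<And>t. T \<le> t \<Longrightarrow> \<eta> / d * ln C \<le> e * ln t"
      using eventually_le_mult_ln[OF e, of "\<eta> / d * ln C"] by (auto simp: eventually_at_top_linorder)
    show "\<exists>\<^sub>F t in at_top. ereal (1 / d * \<eta> - e) \<le> ereal (- ln (b t) / ln t)"
    proof (rule frequently_at_topI)
      fix R
      have "\<not> (\<forall>h\<in>{h \<in> H. \<exists>h'\<in>H. E h h' \<and> D h' < (N h powr \<eta>) powr (- 1 / d)}. N h \<le> max (max R T) 1)"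
        using \<eta> unfolding S_def norm_bounded_def by blast
      then obtain h h' where h: "h \<in> H" "h' \<in> H" "E h h'" "D h' < (N h powr \<eta>) powr (- 1 / d)"
          and large: "max (max R T) 1 < N h"
        by (auto simp only: not_le mem_Collect_eq Ball_def Bex_def not_all not_imp)
      \<comment> \<open>This radius reaches \<open>h'\<close> as well, because
        \<open>N h' \<le> C * N h\<close>. Replacing \<open>ln (N h)\<close> by
        \<open>ln t - ln C\<close> costs \<open>\<eta> / d * ln C\<close>, which is at most
        \<open>e * ln t\<close> by the choice of \<open>T\<close>.\<close>
      define t where "t = C * N h"
      have t: "N h \<le> t" "N h' \<le> t" using C N[OF h(1)] E(3)[OF h(1-3)] by (simp_all add: t_def)
      have lnt: "0 < ln t" using t large by simp
      have "b t \<le> exp (- (\<eta> / d) * ln (N h))"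
        using b_le[OF h(2) t(2)] h(4) powr_eq[OF h(1), of \<eta>] by simp
      then have "ln (b t) \<le> - (\<eta> / d) * ln (N h)"
        using b_pos[OF h(2) t(2)] by (metis ln_exp ln_le_cancel_iff exp_gt_zero)
      also have "ln (N h) = ln t - ln C"
        using C N[OF h(1)] by (simp add: t_def ln_mult)
      finally have "(\<eta> / d - e) * ln t \<le> - ln (b t)"
        using T[of t] t large by (simp add: algebra_simps)
      then have "\<eta> / d - e \<le> - ln (b t) / ln t" using lnt by (simp only: pos_le_divide_eq)
      then have "1 / d * \<eta> - e \<le> - ln (b t) / ln t" by simp
      then show "\<exists>t\<ge>R. ereal (1 / d * \<eta> - e) \<le> ereal (- ln (b t) / ln t)"
        using t large by (intro exI[of _ t]) auto
    qed
  next
    fix e :: real assume e: "0 < e"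
    \<comment> \<open>One fixed element suffices: \<open>b t \<le> D h\<close> bounds
      \<open>ln (b t)\<close> above by a constant.\<close>
    obtain h where h: "h \<in> H" using H by blast
    show "\<forall>\<^sub>F t in at_top. ereal (- e) \<le> ereal (- ln (b t) / ln t)"
      using eventually_gt_at_top[of 1] eventually_ge_at_top[of "N h"]
        eventually_le_mult_ln[OF e, of "ln (D h)"]
    proof eventually_elim
      case (elim t)
      have "0 < b t" by (rule b_pos[OF h elim(2)])
      moreover have "b t \<le> D h" by (rule b_le[OF h elim(2)])
      ultimately have "ln (b t) \<le> ln (D h)" by simp
      then have "- e * ln t \<le> - ln (b t)" using elim by simp
      then have "- e \<le> - ln (b t) / ln t" using elim by (subst pos_le_divide_eq) auto
      then show ?case by simp
    qed
  qed
  then show ?thesis by (simp add: b_def)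
qed

section \<open>Compactness of norm balls from finiteness of their Haar measure\<close>

lemma continuous_map_left_translation:
  assumes "topological_group K T" "h \<in> carrier K"
  shows "continuous_map T T (\<lambda>a. h \<otimes>\<^bsub>K\<^esub> a)"
proof -
  have "continuous_map T (prod_topology T T) (\<lambda>a. (h, a))"
    using assms by (auto simp: topological_group_def intro!: continuous_map_pairedI)
  moreover have "continuous_map (prod_topology T T) T (\<lambda>(a, b). a \<otimes>\<^bsub>K\<^esub> b)"
    using assms by (simp add: topological_group_def)
  ultimately show ?thesis
    using continuous_map_compose by (fastforce simp: o_def)
qed

lemma openin_left_translation:
  fixes K (structure)
  assumes K: "topological_group K T" and h: "h \<in> carrier K" and U: "openin T U"
  shows "openin T (h <#\<^bsub>K\<^esub> U)"
proof -
  interpret group K using K by (simp add: topological_group_def)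
  have T: "topspace T = carrier K" using K by (simp add: topological_group_def)
  then have "U \<subseteq> carrier K" using U openin_subset by blast
  then have "h <#\<^bsub>K\<^esub> U = {a \<in> topspace T. inv h \<otimes> a \<in> U}"
    using h T by (force simp: l_coset_def simp flip: m_assoc)
  then show ?thesis
    using openin_continuous_map_preimage[OF continuous_map_left_translation[OF K] U] h by simp
qed

text \<open>Reversing the multiplication turns a right-invariant measure into a left-invariant one,
  so that a single packing argument serves both kinds of Haar measure.\<close>

lemma opposite_topological_group:
  fixes K (structure)
  assumes "topological_group K T"
  shows "topological_group (K\<lparr>mult := \<lambda>a b. b \<otimes>\<^bsub>K\<^esub> a\<rparr>) T"
proof -
  interpret group K using assms by (simp add: topological_group_def)
  have "group (K\<lparr>mult := \<lambda>a b. b \<otimes> a\<rparr>)"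
    by (rule groupI) (auto simp: m_assoc intro: r_inv_ex)
  moreover have "inv\<^bsub>K\<lparr>mult := \<lambda>a b. b \<otimes> a\<rparr>\<^esub> a = inv a" for a
    by (simp add: m_inv_def conj_commute)
  moreover have "continuous_map (prod_topology T T) T (\<lambda>(a, b). b \<otimes> a)"
    using continuous_map_compose[OF continuous_map_pairedI[OF continuous_map_snd continuous_map_fst],
        of T T T "\<lambda>(a, b). a \<otimes> b"] assms
    by (simp add: topological_group_def o_def case_prod_unfold)
  ultimately show ?thesis
    using assms by (simp add: topological_group_def)
qed

text \<open>Packing argument. A set \<open>S\<close> for which \<open>S V\<close> has finite measure contains only finitely many points with
  pairwise disjoint translates of \<open>V\<close>, and a maximal family of such points exhibits \<open>S\<close> as a subset
  of a compact set.\<close>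

lemma compactin_norm_ball_left:
  fixes K (structure)
  assumes K: "topological_group K T" and lc: "locally_compact_space T" and rad: "radon_measure T m"
    and nz: "emeasure m (space m) \<noteq> 0"
    and inv: "\<And>h A. h \<in> carrier K \<Longrightarrow> A \<in> sets m \<Longrightarrow> emeasure m (h <#\<^bsub>K\<^esub> A) = emeasure m A"
    and N: "group_norm K T N"
    and fin: "\<forall>\<^sub>F t in at_top. emeasure m (norm_ball (carrier K) N t) < \<infinity>"
  shows "compactin T (norm_ball (carrier K) N R)"
proof -
  interpret group K using K by (simp add: topological_group_def)
  have T: "topspace T = carrier K" using K by (simp add: topological_group_def)
  have contN: "continuous_map T euclideanreal N" and Npos: "\<And>h. h \<in> carrier K \<Longrightarrow> 0 < N h"
    using N by (auto simp: group_norm_def)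
  have cont_mult: "continuous_map (prod_topology T T) T (\<lambda>(a, b). a \<otimes> b)"
    and cont_inv: "continuous_map T T (\<lambda>a. inv a)"
    using K by (auto simp: topological_group_def)
  obtain C where C: "\<And>g h. g \<in> carrier K \<Longrightarrow> h \<in> carrier K \<Longrightarrow> N (g \<otimes> h) \<le> C * N g * N h"
    using N by (auto simp: group_norm_def)
  have open_sets: "U \<in> sets m" if "openin T U" for U
    using rad that by (auto simp: radon_measure_def borel_measure_on_def)
  have sp: "space m = topspace T" using rad by (auto simp: radon_measure_def borel_measure_on_def)
  have closed_ball: "closedin T (norm_ball (carrier K) N t)" for t
    using closedin_continuous_map_preimage[OF contN, of "{..t}"] T by (simp add: norm_ball_def)
  have ball_sets: "norm_ball (carrier K) N t \<in> sets m" for t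
  proof -
    have "norm_ball (carrier K) N t = space m - (topspace T - norm_ball (carrier K) N t)"
      using sp T by (auto simp: norm_ball_def)
    also have "\<dots> \<in> sets m" using closed_ball by (intro sets.compl_sets open_sets) auto
    finally show ?thesis .
  qed
  \<comment> \<open>\<open>V\<close> is the set whose translates are packed: openness makes it
    measurable and of positive measure, and the compact \<open>B\<close> around it later confines
    the points of \<open>S\<close>.\<close>
  obtain V B where V: "openin T V" "compactin T B" "\<one> \<in> V" "V \<subseteq> B"
    using lc T by (metis locally_compact_space_def one_closed)
  have BK: "B \<subseteq> carrier K" using V(2) T compactin_subset_topspace by blast
  have hV: "openin T (h <# V)" if "h \<in> carrier K" for h
    using openin_left_translation[OF K that V(1)] .
  have mhV: "emeasure m (h <# V) = emeasure m V" if "h \<in> carrier K" for h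
    using inv[OF that] open_sets V(1) by blast
  \<comment> \<open>If \<open>V\<close> were null, every compact set would be covered by finitely
    many null translates of \<open>V\<close>, and inner regularity on the whole space would make
    \<open>m\<close> vanish.\<close>
  have mV: "emeasure m V \<noteq> 0"
  proof
    assume V0: "emeasure m V = 0"
    have "emeasure m Q = 0" if Q: "compactin T Q" for Q
    proof -
      have QK: "Q \<subseteq> carrier K" using Q T compactin_subset_topspace by blast
      have "Q \<subseteq> \<Union> ((\<lambda>h. h <# V) ` Q)" using V(3) QK by (force simp: l_coset_def)
      moreover have "\<And>U. U \<in> (\<lambda>h. h <# V) ` Q \<Longrightarrow> openin T U" using hV QK by auto
      ultimately obtain \<F> where \<F>: "finite \<F>" "\<F> \<subseteq> (\<lambda>h. h <# V) ` Q" "Q \<subseteq> \<Union>\<F>"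
        using Q unfolding compactin_def by meson
      then obtain F where F: "finite F" "F \<subseteq> Q" "\<F> = (\<lambda>h. h <# V) ` F"
        by (meson finite_subset_image)
      have sets: "(\<lambda>h. h <# V) ` F \<subseteq> sets m" using F(2) QK hV open_sets by auto
      have "emeasure m Q \<le> emeasure m (\<Union>h\<in>F. h <# V)"
        using \<F>(3) F sets by (intro emeasure_mono) auto
      also have "\<dots> \<le> (\<Sum>h\<in>F. emeasure m (h <# V))"
        by (rule emeasure_subadditive_finite[OF F(1) sets])
      also have "\<dots> = 0" using F(2) QK mhV V0 by (intro sum.neutral) auto
      finally show ?thesis by simp
    qed
    moreover have "emeasure m (topspace T) = (SUP Q\<in>{Q. compactin T Q \<and> Q \<subseteq> topspace T}. emeasure m Q)"
      using rad unfolding radon_measure_def by blast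
    ultimately have "emeasure m (topspace T) = 0" by (simp add: SUP_constant bot_ennreal)
    then show False using nz sp by simp
  qed
  obtain L where L: "\<And>b. b \<in> B \<Longrightarrow> N b \<le> L"
  proof -
    have "bounded (N ` B)"
      using image_compactin[OF V(2) contN] compact_imp_bounded by simp
    then obtain a where "\<forall>b\<in>B. \<bar>N b\<bar> \<le> a" by (auto simp: bounded_iff)
    then show ?thesis using that by (meson abs_le_D1)
  qed
  define S where "S = norm_ball (carrier K) N R"
  have SK: "S \<subseteq> carrier K" by (auto simp: S_def norm_ball_def)
  \<comment> \<open>The radius bounds the norm on all \<open>h <# V\<close> with \<open>h\<close> in
    \<open>S\<close>, by submultiplicativity up to \<open>C\<close>. The absolute values are there
    because \<open>C\<close>, \<open>R\<close> and \<open>L\<close> have no known sign.\<close>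
  obtain t where t: "\<bar>C\<bar> * \<bar>R\<bar> * \<bar>L\<bar> \<le> t" "emeasure m (norm_ball (carrier K) N t) < \<infinity>"
    using eventually_conj[OF fin eventually_ge_at_top[of "\<bar>C\<bar> * \<bar>R\<bar> * \<bar>L\<bar>"]]
    by (auto dest: eventually_happens)
  have SV: "h <# V \<subseteq> norm_ball (carrier K) N t" if "h \<in> S" for h
  proof
    fix a assume "a \<in> h <# V"
    then obtain v where v: "v \<in> V" "a = h \<otimes> v" by (auto simp: l_coset_def)
    have hK: "h \<in> carrier K" "v \<in> carrier K" using that SK v V(4) BK by auto
    have "N a \<le> C * N h * N v" using C hK v by simp
    also have "\<dots> \<le> \<bar>C\<bar> * \<bar>R\<bar> * \<bar>L\<bar>"
      using that v V(4) L Npos[OF hK(1)] Npos[OF hK(2)]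
      by (intro mult_mono) (force simp: S_def norm_ball_def)+
    finally show "a \<in> norm_ball (carrier K) N t" using t hK v by (simp add: norm_ball_def)
  qed
  define P where "P F \<longleftrightarrow> finite F \<and> F \<subseteq> S \<and> disjoint_family_on (\<lambda>h. h <# V) F" for F
  define M where "M = measure m (norm_ball (carrier K) N t)"
  \<comment> \<open>Disjoint translates of \<open>V\<close> have equal measure and all fit into one
    ball of finite measure.\<close>
  have card_bound: "real (card F) * measure m V \<le> M" if "P F" for F
  proof -
    have F: "finite F" "F \<subseteq> S" "disjoint_family_on (\<lambda>h. h <# V) F" using that by (auto simp: P_def)
    have "of_nat (card F) * emeasure m V = (\<Sum>h\<in>F. emeasure m (h <# V))"
      using F SK mhV by (simp add: subset_iff)
    also have "\<dots> = emeasure m (\<Union>h\<in>F. h <# V)"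
      using F SK hV open_sets by (intro sum_emeasure) auto
    also have "\<dots> \<le> emeasure m (norm_ball (carrier K) N t)"
      using F SV by (intro emeasure_mono ball_sets) blast
    finally have "enn2real (of_nat (card F) * emeasure m V) \<le> M"
      unfolding M_def measure_def using t(2) by (intro enn2real_mono) auto
    then show ?thesis by (simp add: enn2real_mult measure_def)
  qed
  show ?thesis
  proof (cases "S = {}")
    case True
    then show ?thesis by (simp add: S_def)
  next
    case False
    \<comment> \<open>A translate of \<open>V\<close> by a point of \<open>S\<close> lies in the
      finite ball, so \<open>V\<close> has finite measure. Without this \<open>measure m V\<close>
      could be 0 by its default value at infinity, and \<open>card_bound\<close> would say
      nothing.\<close>
    then obtain s0 where "s0 \<in> S" by blast
    then have "emeasure m V \<le> emeasure m (norm_ball (carrier K) N t)"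
      using mhV[of s0] SK SV[of s0] ball_sets by (metis emeasure_mono subsetD)
    then have "emeasure m V < \<infinity>" using t(2) by (rule le_less_trans)
    then have mV': "0 < measure m V"
      using mV by (simp add: measure_def enn2real_positive_iff zero_less_iff_neq_zero)
    have "P {}" by (simp add: P_def disjoint_family_on_def)
    moreover have "card F < nat \<lceil>M / measure m V\<rceil> + 1" if "P F" for F
    proof -
      have "real (card F) \<le> M / measure m V" using card_bound[OF that] mV' by (simp add: field_simps)
      then show ?thesis by linarith
    qed
    \<comment> \<open>The volume bound limits the cardinality of packings, so a largest one
      exists.\<close>
    ultimately obtain F where F: "P F" "\<And>F'. P F' \<Longrightarrow> card F' \<le> card F"
      using ex_has_greatest_nat[of P "{}" card "nat \<lceil>M / measure m V\<rceil> + 1"] by (metis less_imp_le)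
    have FK: "F \<subseteq> carrier K" and "finite F" using F(1) SK by (auto simp: P_def)
    \<comment> \<open>This is F B B^{-1}. By maximality \<open>s <# V\<close> meets some
      \<open>h <# V\<close> with \<open>h\<close> in \<open>F\<close>, and
      \<open>s \<otimes> v = h \<otimes> w\<close> gives
      \<open>s = h \<otimes> (w \<otimes> inv v)\<close>.\<close>
    define Q where "Q = (\<lambda>(h, b, c). h \<otimes> (b \<otimes> inv c)) ` (F \<times> B \<times> B)"
    have "compactin T Q"
    proof -
      have "compactin T ((\<lambda>(b, c). b \<otimes> inv c) ` (B \<times> B))"
      proof (rule image_compactin)
        show "compactin (prod_topology T T) (B \<times> B)" using V(2) by (simp add: compactin_Times)
        have "continuous_map (prod_topology T T) (prod_topology T T) (\<lambda>z. (fst z, inv (snd z)))"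
        proof (rule continuous_map_pairedI)
          show "continuous_map (prod_topology T T) T (\<lambda>z. inv (snd z))"
            using continuous_map_compose[OF continuous_map_snd cont_inv] by (simp add: o_def)
        qed (rule continuous_map_fst)
        then show "continuous_map (prod_topology T T) T (\<lambda>(b, c). b \<otimes> inv c)"
          using continuous_map_compose[OF _ cont_mult] by (fastforce simp: o_def case_prod_unfold)
      qed
      then have "compactin T ((\<lambda>a. h \<otimes> a) ` (\<lambda>(b, c). b \<otimes> inv c) ` (B \<times> B))" if "h \<in> F" for h
        using continuous_map_left_translation[OF K] FK that by (blast intro: image_compactin)
      then have "compactin T (\<Union>h\<in>F. (\<lambda>a. h \<otimes> a) ` (\<lambda>(b, c). b \<otimes> inv c) ` (B \<times> B))"
        using \<open>finite F\<close> by (intro compactin_Union) auto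
      also have "(\<Union>h\<in>F. (\<lambda>a. h \<otimes> a) ` (\<lambda>(b, c). b \<otimes> inv c) ` (B \<times> B)) = Q"
        by (force simp: Q_def)
      finally show ?thesis .
    qed
    moreover have "S \<subseteq> Q"
    proof
      fix s assume s: "s \<in> S"
      have "\<exists>h\<in>F. (s <# V) \<inter> (h <# V) \<noteq> {}"
      proof (rule ccontr)
        assume *: "\<not> ?thesis"
        have "s \<in> s <# V" using s SK V(3) by (force simp: l_coset_def)
        with * have "s \<notin> F" by auto
        moreover have "P (insert s F)"
          using F(1) s * by (auto simp: P_def disjoint_family_on_def)
        ultimately show False using F(2)[of "insert s F"] \<open>finite F\<close> by simp
      qed
      then obtain h v w where h: "h \<in> F" "v \<in> V" "w \<in> V" "s \<otimes> v = h \<otimes> w"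
        by (auto simp: l_coset_def)
      have "s \<in> carrier K" "h \<in> carrier K" "v \<in> carrier K" "w \<in> carrier K"
        using s h SK FK V(4) BK by auto
      then have "s = h \<otimes> (w \<otimes> inv v)"
        using h(4) by (metis inv_closed m_assoc inv_solve_right m_closed)
      then show "s \<in> Q" using h V(4) by (force simp: Q_def)
    qed
    ultimately show ?thesis
      using closed_compactin closed_ball unfolding S_def by blast
  qed
qed

lemma compactin_norm_ball:
  assumes K: "topological_group K T" and lc: "locally_compact_space T" and m: "haar_measure K T m"
    and N: "group_norm K T N"
    and fin: "\<forall>\<^sub>F t in at_top. emeasure m (norm_ball (carrier K) N t) < \<infinity>"
  shows "compactin T (norm_ball (carrier K) N R)"
proof -
  have rad: "radon_measure T m" and nz: "emeasure m (space m) \<noteq> 0"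
    using m by (auto simp: haar_measure_def)
  consider "\<forall>h\<in>carrier K. \<forall>A\<in>sets m. emeasure m (h <#\<^bsub>K\<^esub> A) = emeasure m A"
    | "\<forall>h\<in>carrier K. \<forall>A\<in>sets m. emeasure m (A #>\<^bsub>K\<^esub> h) = emeasure m A"
    using m by (auto simp: haar_measure_def)
  then show ?thesis
  proof cases
    case 1
    then show ?thesis using compactin_norm_ball_left[OF K lc rad nz _ N fin] by blast
  next
    case 2
    let ?K = "K\<lparr>mult := \<lambda>a b. b \<otimes>\<^bsub>K\<^esub> a\<rparr>"
    obtain C where C: "\<And>g h. g \<in> carrier K \<Longrightarrow> h \<in> carrier K \<Longrightarrow> N (g \<otimes>\<^bsub>K\<^esub> h) \<le> C * N g * N h"
      using N by (auto simp: group_norm_def)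
    \<comment> \<open>The bound \<open>C * N g * N h\<close> is symmetric in \<open>g\<close> and
      \<open>h\<close>, so the same \<open>C\<close> serves the reversed product.\<close>
    have "N (h \<otimes>\<^bsub>K\<^esub> g) \<le> C * N g * N h" if "g \<in> carrier K" "h \<in> carrier K" for g h
      using C[of h g] that by (simp add: mult_ac)
    then have "group_norm ?K T N"
      using N by (auto simp: group_norm_def)
    moreover have "emeasure m (h <#\<^bsub>?K\<^esub> A) = emeasure m A" if "h \<in> carrier ?K" "A \<in> sets m" for h A
      using 2 that by (simp add: l_coset_def r_coset_def)
    ultimately show ?thesis
      using compactin_norm_ball_left[OF opposite_topological_group[OF K] lc rad nz] fin by simp
  qed
qed

section \<open>Orbit maps, thickened balls and measure exponents\<close>

text \<open>For \<open>x\<close> the coset of \<open>g\<close>, the orbit map is the inclusion of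
  \<open>H\<close> into \<open>G\<close>, followed by left translation by \<open>g\<close> and the
  quotient map.\<close>

lemma continuous_map_orbit:
  assumes G: "topological_group G T" and \<Gamma>: "subgroup \<Gamma> G" and H: "H \<subseteq> carrier G"
    and TH: "continuous_map T\<^sub>H T (\<lambda>h. h)" "topspace T\<^sub>H = H"
    and x: "x \<in> rcosets\<^bsub>G\<^esub> \<Gamma>"
  shows "continuous_map T\<^sub>H (quotient_topology G T \<Gamma>) (\<lambda>h. x #>\<^bsub>G\<^esub> h)"
proof -
  interpret group G using G by (simp add: topological_group_def)
  have T: "topspace T = carrier G" using G by (simp add: topological_group_def)
  have \<Gamma>G: "\<Gamma> \<subseteq> carrier G" using \<Gamma> by (rule subgroup.subset)
  obtain g where g: "g \<in> carrier G" "x = \<Gamma> #>\<^bsub>G\<^esub> g" using x by (auto simp: RCOSETS_def)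
  have quot: "continuous_map T (quotient_topology G T \<Gamma>) (\<lambda>a. \<Gamma> #>\<^bsub>G\<^esub> a)"
  proof -
    have "{a \<in> carrier G. \<Gamma> #>\<^bsub>G\<^esub> a \<in> rcosets\<^bsub>G\<^esub> \<Gamma>} = carrier G"
      using \<Gamma>G by (auto intro: rcosetsI)
    then have "openin (quotient_topology G T \<Gamma>) (rcosets\<^bsub>G\<^esub> \<Gamma>)"
      using T openin_topspace[of T] by (simp add: openin_quotient_topology)
    then have "topspace (quotient_topology G T \<Gamma>) = rcosets\<^bsub>G\<^esub> \<Gamma>"
      using openin_quotient_topology[OF T] openin_subset openin_topspace by blast
    then show ?thesis
      using \<Gamma>G T by (auto simp: continuous_map_def openin_quotient_topology intro: rcosetsI)
  qed
  have "continuous_map T\<^sub>H T (\<lambda>h. g \<otimes>\<^bsub>G\<^esub> h)"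
    using continuous_map_compose[OF TH(1) continuous_map_left_translation[OF G g(1)]] by (simp add: o_def)
  from continuous_map_compose[OF this quot] show ?thesis
    by (rule continuous_map_eq) (use g H TH(2) \<Gamma>G in \<open>auto simp: coset_mult_assoc\<close>)
qed

text \<open>If \<open>x #> h = z #> k\<close> with \<open>k\<close> in the unit norm ball, then
  \<open>z = x #> h'\<close> for \<open>h' = h \<otimes> inv k\<close>, so \<open>z\<close> is on
  the same orbit. Thickening thus becomes a relation between \<open>h\<close> and \<open>h'\<close>
  inside \<open>H\<close>.\<close>

lemma thickened_ball_iff:
  fixes G (structure)
  assumes "group G" "subgroup \<Gamma> G" "subgroup H G" "Metric_space (rcosets \<Gamma>) dst"
    and x: "x \<in> rcosets \<Gamma>" and y: "y \<in> rcosets \<Gamma>" and h: "h \<in> H"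
  shows "x #> h \<in> thickened_ball G \<Gamma> H N dst y s \<longleftrightarrow>
    (\<exists>h'\<in>H. inv h' \<otimes> h \<in> norm_ball H N 1 \<and> dst (x #> h') y < s)"
proof -
  interpret group G by fact
  interpret Metric_space "rcosets \<Gamma>" dst by fact
  interpret H: subgroup H G by fact
  have sub: "z \<subseteq> carrier G" if "z \<in> rcosets \<Gamma>" for z
    using rcosets_part_G[OF assms(2)] that by blast
  have act: "z #> g \<in> rcosets \<Gamma>" if "z \<in> rcosets \<Gamma>" "g \<in> carrier G" for z g
    using that subgroup.subset[OF assms(2)] by (auto simp: RCOSETS_def coset_mult_assoc)
  show ?thesis
  proof
    assume "x #> h \<in> thickened_ball G \<Gamma> H N dst y s"
    then obtain z k where z: "x #> h = z #> k" "z \<in> rcosets \<Gamma>" "dst y z < s" "k \<in> H" "N k \<le> 1"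
      by (auto simp: thickened_ball_def norm_ball_def)
    have "x #> (h \<otimes> inv k) = (x #> h) #> inv k"
      using sub[OF x] h z(4) by (simp add: coset_mult_assoc)
    also have "\<dots> = z" using sub[OF z(2)] z(1,4) by (simp add: coset_mult_assoc)
    finally have "dst (x #> (h \<otimes> inv k)) y < s" using z(3) commute by simp
    moreover have "inv (h \<otimes> inv k) \<otimes> h = k" using h z(4) by (simp add: inv_mult_group m_assoc)
    ultimately show "\<exists>h'\<in>H. inv h' \<otimes> h \<in> norm_ball H N 1 \<and> dst (x #> h') y < s"
      using h z(4,5) by (intro bexI[of _ "h \<otimes> inv k"]) (auto simp: norm_ball_def)
  next
    assume "\<exists>h'\<in>H. inv h' \<otimes> h \<in> norm_ball H N 1 \<and> dst (x #> h') y < s"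
    then obtain h' where h': "h' \<in> H" "inv h' \<otimes> h \<in> norm_ball H N 1" "dst (x #> h') y < s"
      by blast
    have "x #> h = (x #> h') #> (inv h' \<otimes> h)"
      using sub[OF x] h h'(1) by (simp add: coset_mult_assoc flip: m_assoc)
    moreover have "x #> h' \<in> mball y s"
      using h' act[OF x] y commute by simp
    ultimately show "x #> h \<in> thickened_ball G \<Gamma> H N dst y s"
      using h'(2) unfolding thickened_ball_def by blast
  qed
qed

text \<open>A negative power blows up at 0 and cannot be dominated by a bounded function, and a
  positive power cannot be dominated by 0. For thickened balls this gives a positive exponent and a
  nonempty target.\<close>

lemma bigtheta_powr_at_right_0:
  fixes f :: "real \<Rightarrow> real"
  assumes "f \<in> \<Theta>[at_right 0](\<lambda>s. s powr d)" "d \<noteq> 0" and bound: "\<And>s. \<bar>f s\<bar> \<le> 1"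
  shows "0 < d" and "\<exists>s. f s \<noteq> 0"
proof -
  obtain c where c: "0 < c" "\<forall>\<^sub>F s in at_right 0. norm (s powr d) \<le> c * norm (f s)"
    using assms(1) by (auto simp: bigtheta_def bigomega_iff_bigo elim: landau_o.bigE)
  have gt: "\<forall>\<^sub>F s::real in at_right 0. 0 < s" by (rule eventually_at_right_less)
  have "\<forall>\<^sub>F s in at_right 0. f s \<noteq> 0"
    using c(2) gt by eventually_elim auto
  then show "\<exists>s. f s \<noteq> 0"
    using eventually_happens trivial_limit_at_right_real by blast
  show "0 < d"
  proof (rule ccontr)
    assume "\<not> 0 < d"
    then have "d < 0" using assms(2) by simp
    \<comment> \<open>The threshold \<open>c powr (1 / d)\<close> is where the decreasing function
      \<open>s powr d\<close> equals \<open>c\<close>.\<close>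
    have "c < s powr d" if "0 < s" "s < c powr (1 / d)" for s
      using powr_less_mono2_neg[OF \<open>d < 0\<close> that] \<open>d < 0\<close> c(1) by (simp add: powr_powr)
    then have "\<forall>\<^sub>F s in at_right 0. c < s powr d"
      using c(1) by (auto simp: eventually_at_right_field intro!: exI[of _ "c powr (1 / d)"])
    with c(2) gt have "\<forall>\<^sub>F s::real in at_right 0. False"
    proof eventually_elim
      case (elim s)
      have "c * norm (f s) \<le> c * 1" using bound[of s] c(1) by (intro mult_left_mono) auto
      then show ?case using elim by simp
    qed
    then show False by (simp add: trivial_limit_at_right_real)
  qed
qed

section \<open>Rates of excursion and approach on the homogeneous space\<close>

theorem proposition1p2:
  fixes G :: "('g, 'b) monoid_scheme"
    and T T\<^sub>H :: "'g topology"
    and \<A> :: "('g set \<times> ('g \<Rightarrow> 'e::euclidean_space)) set"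
    and \<Gamma> H :: "'g set"
    and \<mu> :: "'g set measure"
    and m :: "'g measure"
    and N :: "'g \<Rightarrow> real"
    and dlo dhi :: real
    and dst :: "'g set \<Rightarrow> 'g set \<Rightarrow> real"
    and p :: "'g set"
  assumes "semisimple_lie_group G T \<A>"
    and "lattice_subgroup G T \<Gamma>"
    and "invariant_probability G T \<Gamma> \<mu>"
    and "locally_compact_subgroup G T H T\<^sub>H"
    and "ergodic_action G H \<mu>"
    and "haar_measure (G\<lparr>carrier := H\<rparr>) T\<^sub>H m"
    and "group_norm (G\<lparr>carrier := H\<rparr>) T\<^sub>H N"
    and "dlo \<le> dhi"
    and "norm_growth m H N dlo dhi"
    and "Metric_space (rcosets\<^bsub>G\<^esub> \<Gamma>) dst"
    and "Metric_space.mtopology (rcosets\<^bsub>G\<^esub> \<Gamma>) dst = quotient_topology G T \<Gamma>"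
    and "p \<in> rcosets\<^bsub>G\<^esub> \<Gamma>"
    and "\<not> compact_space (quotient_topology G T \<Gamma>) \<longrightarrow>
           (\<lambda>s. measure \<mu> (ball_at_infinity (rcosets\<^bsub>G\<^esub> \<Gamma>) dst p s)) \<in> \<Theta>[at_top](\<lambda>s. exp (- s))"
  shows
    "(\<not> compact_space (quotient_topology G T \<Gamma>) \<longrightarrow>
       (\<forall>x\<in>rcosets\<^bsub>G\<^esub> \<Gamma>.
          let A = (\<lambda>t. ball_at_infinity (rcosets\<^bsub>G\<^esub> \<Gamma>) dst p (ln t)) in
          critical_exponent_defined G H N A x \<longrightarrow>
          Limsup at_top (\<lambda>t. beta_sup G H N dst p t x / ereal (ln t))
            = ereal (critical_exponent G H N A x)))
     \<and>
     (\<forall>y\<in>rcosets\<^bsub>G\<^esub> \<Gamma>. \<forall>d\<^sub>0. d\<^sub>0 \<noteq> 0 \<longrightarrow>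
       (\<lambda>s. measure \<mu> (thickened_ball G \<Gamma> H N dst y s)) \<in> \<Theta>[at_right 0](\<lambda>s. s powr d\<^sub>0) \<longrightarrow>
       (\<forall>x\<in>rcosets\<^bsub>G\<^esub> \<Gamma>.
          let A = (\<lambda>t. thickened_ball G \<Gamma> H N dst y (t powr (- 1 / d\<^sub>0))) in
          critical_exponent_defined G H N A x \<longrightarrow>
          y \<in> (\<lambda>h. x #>\<^bsub>G\<^esub> h) ` H \<or>
          Limsup at_top (\<lambda>t. ereal (- ln (beta_inf G H N dst t x y) / ln t))
            = ereal (critical_exponent G H N A x / d\<^sub>0)))"
proof -
  define K where "K = G\<lparr>carrier := H\<rparr>"
  let ?X = "rcosets\<^bsub>G\<^esub> \<Gamma>"
  have G: "topological_group G T"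
    using assms(1) by (simp add: semisimple_lie_group_def lie_group_def)
  interpret group G using G by (simp add: topological_group_def)
  have \<Gamma>: "subgroup \<Gamma> G" using assms(2) by (simp add: lattice_subgroup_def)
  have H: "subgroup H G" and K: "topological_group K T\<^sub>H" and lc: "locally_compact_space T\<^sub>H"
    and inc: "continuous_map T\<^sub>H T (\<lambda>h. h)"
    using assms(4) by (auto simp: locally_compact_subgroup_def K_def)
  interpret H: subgroup H G by (rule H)
  have TH: "topspace T\<^sub>H = H" using K by (simp add: topological_group_def K_def)
  interpret Metric_space ?X dst by fact
  interpret \<mu>: prob_space \<mu> using assms(3) by (simp add: invariant_probability_def)
  have Hne: "H \<noteq> {}" using H.one_closed by blast
  have contN: "continuous_map T\<^sub>H euclideanreal N" and Npos: "\<And>h. h \<in> H \<Longrightarrow> 0 < N h"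
    using assms(7) by (auto simp: group_norm_def)
  have act: "x #>\<^bsub>G\<^esub> h \<in> ?X" if "x \<in> ?X" "h \<in> H" for x h
    using that subgroup.subset[OF \<Gamma>] by (auto simp: RCOSETS_def coset_mult_assoc)
  have "\<forall>\<^sub>F t in at_top. emeasure m (norm_ball (carrier K) N t) < \<infinity>"
  proof -
    \<comment> \<open>The upper growth bound is used with \<epsilon> = 1; any finite bound would
      do.\<close>
    obtain c where "\<forall>\<^sub>F t in at_top. emeasure m (norm_ball H N t) \<le> ennreal (c * t powr (dhi + 1))"
      using assms(9) unfolding norm_growth_def eventually_conj_iff by (metis zero_less_one)
    then show ?thesis
      by eventually_elim (auto simp: K_def intro: le_less_trans)
  qed
  then have "compactin T\<^sub>H (norm_ball (carrier K) N R)" for R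
    using compactin_norm_ball[OF K lc] assms(6,7) by (simp add: K_def)
  then have cpt: "compactin T\<^sub>H (norm_ball H N R)" for R by (simp add: K_def)
  \<comment> \<open>Compactness of the distance values gives boundedness in the first part and an
    attained minimum in the second.\<close>
  have cpt_dst: "compact ((\<lambda>h. dst (x #>\<^bsub>G\<^esub> h) z) ` norm_ball H N R)" if "x \<in> ?X" "z \<in> ?X" for x z R
  proof -
    have "continuous_map T\<^sub>H mtopology (\<lambda>h. x #>\<^bsub>G\<^esub> h)"
      using continuous_map_orbit[OF G \<Gamma> H.subset inc TH that(1)] assms(11) by simp
    then have "continuous_map T\<^sub>H euclideanreal (\<lambda>h. mdist Self (x #>\<^bsub>G\<^esub> h) z)"
      using that(2) by (intro continuous_map_mdist) (simp_all add: mtopology_of_def)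
    then show ?thesis using image_compactin[OF cpt] by fastforce
  qed
  have part1: "Limsup at_top (\<lambda>t. beta_sup G H N dst p t x / ereal (ln t)) = ereal (critical_exponent G H N A x)"
    if x: "x \<in> ?X" and A: "A = (\<lambda>t. ball_at_infinity ?X dst p (ln t))"
      and def: "critical_exponent_defined G H N A x" for x A
  proof -
    have S: "critical_set G H N A x =
        {\<eta>. 0 \<le> \<eta> \<and> norm_bounded N {h \<in> H. ln (N h powr \<eta>) < dst (x #>\<^bsub>G\<^esub> h) p}}"
      unfolding critical_set_def A ball_at_infinity_def
      using act[OF x] by (simp cong: conj_cong)
    show ?thesis
      unfolding beta_sup_def critical_exponent_def S
    proof (rule limsup_sup_orbit[OF Hne])
      show "{\<eta>. 0 \<le> \<eta> \<and> norm_bounded N {h \<in> H. ln (N h powr \<eta>) < dst (x #>\<^bsub>G\<^esub> h) p}} \<noteq> {}"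
        using def by (simp add: critical_exponent_defined_def S)
      show "\<exists>C. \<forall>h\<in>norm_ball H N R. dst (x #>\<^bsub>G\<^esub> h) p \<le> C" for R
        using compact_imp_bounded[OF cpt_dst[OF x assms(12)]] by (force simp: bounded_iff)
    qed (use Npos in auto)
  qed
  have part2: "Limsup at_top (\<lambda>t. ereal (- ln (beta_inf G H N dst t x y) / ln t))
      = ereal (critical_exponent G H N A x / d\<^sub>0)"
    if y: "y \<in> ?X" and d0: "d\<^sub>0 \<noteq> 0"
      and \<Theta>: "(\<lambda>s. measure \<mu> (thickened_ball G \<Gamma> H N dst y s)) \<in> \<Theta>[at_right 0](\<lambda>s. s powr d\<^sub>0)"
      and x: "x \<in> ?X" and A: "A = (\<lambda>t. thickened_ball G \<Gamma> H N dst y (t powr (- 1 / d\<^sub>0)))"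
      and def: "critical_exponent_defined G H N A x" and notin: "y \<notin> (\<lambda>h. x #>\<^bsub>G\<^esub> h) ` H"
    for x y d\<^sub>0 A
  proof -
    \<comment> \<open>A group norm is only required to be positive, so the unit ball might be empty.
      A thickened ball of nonzero measure excludes this and provides \<open>u\<close>.\<close>
    have d0_pos: "0 < d\<^sub>0" and "\<exists>s. measure \<mu> (thickened_ball G \<Gamma> H N dst y s) \<noteq> 0"
      using bigtheta_powr_at_right_0[OF \<Theta> d0] \<mu>.prob_le_1 by auto
    then obtain u where u: "u \<in> norm_ball H N 1"
      by (cases "norm_ball H N 1 = {}") (auto simp: thickened_ball_def)
    obtain C where C: "\<And>g h. g \<in> H \<Longrightarrow> h \<in> H \<Longrightarrow> N (g \<otimes>\<^bsub>G\<^esub> h) \<le> C * N g * N h"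
      using assms(7) by (auto simp: group_norm_def)
    \<comment> \<open>\<open>group_norm\<close> says nothing about inverses; the bound comes from
      continuity of inversion on the compact unit ball.\<close>
    obtain L where L: "\<And>h. h \<in> norm_ball H N 1 \<Longrightarrow> N (inv\<^bsub>G\<^esub> h) \<le> L"
    proof -
      have "continuous_map T\<^sub>H euclideanreal (N \<circ> (\<lambda>h. inv\<^bsub>K\<^esub> h))"
        using K contN by (intro continuous_map_compose) (auto simp: topological_group_def)
      from image_compactin[OF cpt this]
      have "bounded ((N \<circ> (\<lambda>h. inv\<^bsub>K\<^esub> h)) ` norm_ball H N 1)"
        by (intro compact_imp_bounded) simp
      then obtain a where a: "\<forall>h\<in>norm_ball H N 1. \<bar>N (inv\<^bsub>K\<^esub> h)\<bar> \<le> a"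
        by (auto simp: bounded_iff)
      show ?thesis
      proof (rule that)
        fix h assume "h \<in> norm_ball H N 1"
        moreover from this have "inv\<^bsub>K\<^esub> h = inv\<^bsub>G\<^esub> h"
          using m_inv_consistent[OF H] by (simp add: K_def norm_ball_def)
        ultimately show "N (inv\<^bsub>G\<^esub> h) \<le> a" using a by (metis abs_le_D1)
      qed
    qed
    define E where "E h h' \<longleftrightarrow> inv\<^bsub>G\<^esub> h' \<otimes>\<^bsub>G\<^esub> h \<in> norm_ball H N 1" for h h'
    \<comment> \<open>One constant for both directions: h = h' k costs a factor \<open>C\<close>,
      and h' = h k^{-1} a factor \<open>C * L\<close>.\<close>
    define M where "M = max 1 \<bar>C\<bar> * max 1 \<bar>L\<bar>"
    have M: "1 \<le> M" "\<bar>C\<bar> \<le> M" "\<bar>C\<bar> * \<bar>L\<bar> \<le> M"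
      unfolding M_def using mult_mono[of 1 "max 1 \<bar>C\<bar>" 1 "max 1 \<bar>L\<bar>"]
        mult_mono[of "\<bar>C\<bar>" "max 1 \<bar>C\<bar>" 1 "max 1 \<bar>L\<bar>"]
      by (auto intro!: mult_mono)
    have S: "critical_set G H N A x = {\<eta>. 0 \<le> \<eta> \<and> norm_bounded N
        {h \<in> H. \<exists>h'\<in>H. E h h' \<and> dst (x #>\<^bsub>G\<^esub> h') y < (N h powr \<eta>) powr (- 1 / d\<^sub>0)}}"
      unfolding critical_set_def A E_def
      using thickened_ball_iff[OF is_group \<Gamma> H Metric_space_axioms x y] by (simp cong: conj_cong)
    show ?thesis
      unfolding beta_inf_def critical_exponent_def S
    proof (rule limsup_inf_orbit[OF Hne _ d0_pos M(1)])
      show "{\<eta>. 0 \<le> \<eta> \<and> norm_bounded N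
        {h \<in> H. \<exists>h'\<in>H. E h h' \<and> dst (x #>\<^bsub>G\<^esub> h') y < (N h powr \<eta>) powr (- 1 / d\<^sub>0)}} \<noteq> {}"
        using def by (simp add: critical_exponent_defined_def S)
    next
      fix h' assume h': "h' \<in> H"
      have "u \<in> H" using u by (simp add: norm_ball_def)
      then show "\<exists>h\<in>H. E h h'"
        using u h' by (intro bexI[of _ "h' \<otimes>\<^bsub>G\<^esub> u"]) (auto simp: E_def simp flip: m_assoc)
    next
      fix h h' assume h: "h \<in> H" "h' \<in> H" "E h h'"
      define k where "k = inv\<^bsub>G\<^esub> h' \<otimes>\<^bsub>G\<^esub> h"
      have k: "k \<in> H" "N k \<le> 1" "N (inv\<^bsub>G\<^esub> k) \<le> L"
        using h(3) L by (auto simp: E_def k_def norm_ball_def)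
      have "N h = N (h' \<otimes>\<^bsub>G\<^esub> k)" using h by (simp add: k_def flip: m_assoc)
      also have "\<dots> \<le> C * N h' * N k" using C h k by simp
      also have "\<dots> \<le> M * N h' * 1"
        using M Npos[OF h(2)] Npos[OF k(1)] k by (intro mult_mono) auto
      finally show "N h \<le> M * N h'" by simp
      have "N h' = N (h \<otimes>\<^bsub>G\<^esub> inv\<^bsub>G\<^esub> k)"
        using h by (simp add: k_def inv_mult_group flip: m_assoc)
      also have "\<dots> \<le> C * N h * N (inv\<^bsub>G\<^esub> k)" using C h k by simp
      also have "\<dots> \<le> \<bar>C\<bar> * N h * \<bar>L\<bar>"
        using Npos[OF h(1)] Npos[of "inv\<^bsub>G\<^esub> k"] k by (intro mult_mono) auto
      also have "\<dots> \<le> M * N h" using mult_right_mono[OF M(3), of "N h"] Npos[OF h(1)] by (simp add: mult_ac)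
      finally show "N h' \<le> M * N h" .
    next
      fix R
      show "\<exists>\<delta>>0. \<forall>h\<in>norm_ball H N R. \<delta> \<le> dst (x #>\<^bsub>G\<^esub> h) y"
      proof (cases "norm_ball H N R = {}")
        case True
        then show ?thesis by (auto intro: exI[of _ 1])
      next
        case False
        then obtain h where h: "h \<in> norm_ball H N R"
            "\<forall>k\<in>norm_ball H N R. dst (x #>\<^bsub>G\<^esub> h) y \<le> dst (x #>\<^bsub>G\<^esub> k) y"
          using compact_attains_inf[OF cpt_dst[OF x y, of R]] by blast
        \<comment> \<open>The minimum over the ball is attained at the orbit point of
          \<open>h\<close>, which differs from \<open>y\<close> because \<open>y\<close> is off the
          orbit.\<close>
        have "h \<in> H" using h(1) by (simp add: norm_ball_def)
        then have "0 < dst (x #>\<^bsub>G\<^esub> h) y"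
          using notin act[OF x] y by (intro mdist_pos_less) auto
        then show ?thesis using h(2) by blast
      qed
    qed (use Npos in auto)
  qed
  show ?thesis
    unfolding Let_def using part1 part2 by blast
qed

end
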